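(* Let $P$ be a finite set of primes different from $3$ (that is, $3\notin P$). For the pairwise distinct moduli consisting of $3$ together with $3p$ for each $p\in P$, i.e. for the list $\mathbf n=\bigl(3,(3p)_{p\in P}\bigr)$, one has $$\mu(\mathbf n)=\frac13\min_{P=P_1\mathbin{\dot\cup}P_2}\left\{\prod_{p\in P_1}\left(1-\frac1p\right)+\prod_{p\in P_2}\left(1-\frac1p\right)\right\},$$ where the minimum is over all ordered pairs $(P_1,P_2)$ of disjoint (possibly empty) sets with union $P$, and an empty product equals $1$.
   Context: For a finite list $\mathbf n=(n_1,\ldots,n_r)$ of positive integers (moduli), define $$\mu(\mathbf n)=\min_{0\le a_i<n_i}\operatorname{dens}\left(\mathbb Z\setminus\bigcup_{i=1}^r(a_i+n_i\mathbb Z)\right),$$ where the minimum is over all tuples of integers $(a_1,\ldots,a_r)$ with $0\le a_i<n_i$ for each $i$. For each tuple the set whose density is taken is periodic modulo $L=\operatorname{lcm}(n_1,\ldots,n_r)$, and its density $\operatorname{dens}$ is the proportion of elements of $\{0,\ldots,L-1\}$ belonging to it. *)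

theory Defs
  imports Complex_Main "HOL-Computational_Algebra.Primes"
begin

definition residue_class :: "int \<Rightarrow> nat \<Rightarrow> int set" where
  "residue_class a n = {a + int n * k | k. True}"

definition uncovered :: "nat list \<Rightarrow> int list \<Rightarrow> int set" where
  "uncovered ns as = UNIV - (\<Union>i<length ns. residue_class (as ! i) (ns ! i))"

(* Meaningful only for sets S that are periodic modulo L, with L > 0. *)
definition periodic_dens :: "nat \<Rightarrow> int set \<Rightarrow> real" where
  "periodic_dens L S = real (card (S \<inter> {0..<int L})) / real L"

definition residue_tuples :: "nat list \<Rightarrow> int list set" where
  "residue_tuples ns =
     {as. length as = length ns \<and> (\<forall>i<length ns. 0 \<le> as ! i \<and> as ! i < int (ns ! i))}"

(* Intended for lists of positive moduli: then the minimum is over a finite nonempty set. *)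
definition \<mu> :: "nat list \<Rightarrow> real" where
  "\<mu> ns = Min {periodic_dens (Lcm (set ns)) (uncovered ns as) | as. as \<in> residue_tuples ns}"

lemma finite_residue_tuples: "finite (residue_tuples ns)"
proof (rule finite_subset)
  show "residue_tuples ns \<subseteq> {as. set as \<subseteq> (\<Union>n\<in>set ns. {0..<int n}) \<and> length as = length ns}"
    unfolding residue_tuples_def by (fastforce simp: in_set_conv_nth)
  show "finite {as. set as \<subseteq> (\<Union>n\<in>set ns. {0..<int n}) \<and> length as = length ns}"
    by (rule finite_lists_length_eq) auto
qed

lemma residue_tuples_nonempty:
  assumes "\<forall>n\<in>set ns. n > 0"
  shows "residue_tuples ns \<noteq> {}"
proof -
  have "replicate (length ns) 0 \<in> residue_tuples ns"
    using assms by (auto simp: residue_tuples_def)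
  then show ?thesis by blast
qed

lemma uncovered_periodic:
  "x + int (Lcm (set ns)) \<in> uncovered ns as \<longleftrightarrow> x \<in> uncovered ns as"
proof -
  have "x + int (Lcm (set ns)) \<in> residue_class a n \<longleftrightarrow> x \<in> residue_class a n"
    if n: "n \<in> set ns" for a n
  proof -
    have mem_iff: "y \<in> residue_class a n \<longleftrightarrow> int n dvd y - a" for y
      unfolding residue_class_def dvd_def by (auto simp: algebra_simps)
    have "int n dvd int (Lcm (set ns))"
      using n by (simp add: dvd_Lcm)
    then have "int n dvd (x - a) + int (Lcm (set ns)) \<longleftrightarrow> int n dvd x - a"
      by (rule dvd_add_left_iff)
    then show ?thesis
      unfolding mem_iff by (simp add: algebra_simps)
  qed
  then show ?thesis
    by (simp add: uncovered_def)
qed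

end

theory Submission
  imports Defs "HOL-Number_Theory.Cong"
begin

text \<open>
  The modulus \<open>3\<close> removes one residue class modulo \<open>3\<close>; the other two survive. A class modulo
  \<open>3 * p\<close> lies inside exactly one class modulo \<open>3\<close>, and there it acts as a class modulo \<open>p\<close>.
  Since \<open>3\<close> and the primes in \<open>P\<close> are pairwise coprime, the conditions modulo these primes are
  independent by the Chinese remainder theorem (\<open>periodic_dens_INT\<close>), so the uncovered part of a
  surviving class \<open>c\<close> has density one third of the product of \<open>1 - 1/p\<close> over those \<open>p\<close> whose class
  lies in \<open>c\<close> (\<open>dens_sieved_class_mod_3\<close>).

  A choice of residues therefore sends each prime to one of the two surviving classes, or wastes it
  on the class that is already covered. Every ordered partition of \<open>P\<close> arises from a choice
  without waste, which gives one inequality. For the other, hand the wasted primes to one of the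
  surviving classes: as all factors lie between \<open>0\<close> and \<open>1\<close>, this does not increase the density.
\<close>

section \<open>Multiplicativity of periodic densities\<close>

lemma bij_betw_int_mod_pair:
  assumes "coprime m n" "m > 0" "n > 0"
  shows "bij_betw (\<lambda>x. (x mod int m, x mod int n)) {0..<int (m * n)} ({0..<int m} \<times> {0..<int n})"
    (is "bij_betw ?f ?A ?B")
proof -
  have inj: "inj_on ?f ?A"
  proof (rule inj_onI)
    fix x y assume x: "x \<in> ?A" and y: "y \<in> ?A" and "?f x = ?f y"
    then have "[x = y] (mod int m)" "[x = y] (mod int n)"
      by (simp_all add: cong_def)
    then have "[x = y] (mod (int m * int n))"
      using assms(1) by (intro coprime_cong_mult) auto
    then show "x = y"
      using x y by (simp add: cong_def)
  qed
  have "?f ` ?A \<subseteq> ?B"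
    using assms by auto
  moreover have "card (?f ` ?A) = card ?B"
    by (subst card_image[OF inj]) (simp add: nat_mult_distrib)
  ultimately have "?f ` ?A = ?B"
    by (intro card_subset_eq) auto
  with inj show ?thesis
    by (simp add: bij_betw_def)
qed

text \<open>
  Under the Chinese remainder bijection, the elements of \<open>A \<inter> B\<close> in one period correspond to
  the pairs of an element of \<open>A\<close> and one of \<open>B\<close> in their own periods.
\<close>

lemma periodic_dens_Int:
  assumes "coprime m n" "m > 0" "n > 0"
    and A: "\<And>x. x mod int m \<in> A \<longleftrightarrow> x \<in> A"
    and B: "\<And>x. x mod int n \<in> B \<longleftrightarrow> x \<in> B"
  shows "periodic_dens (m * n) (A \<inter> B) = periodic_dens m A * periodic_dens n B"
proof -
  let ?f = "\<lambda>x. (x mod int m, x mod int n)"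
  note bij = bij_betw_int_mod_pair[OF assms(1-3)]
  have image: "?f ` (A \<inter> B \<inter> {0..<int (m * n)}) = (A \<inter> {0..<int m}) \<times> (B \<inter> {0..<int n})"
  proof (intro equalityI subsetI)
    fix z assume "z \<in> ?f ` (A \<inter> B \<inter> {0..<int (m * n)})"
    then show "z \<in> (A \<inter> {0..<int m}) \<times> (B \<inter> {0..<int n})"
      using assms by auto
  next
    fix z assume z: "z \<in> (A \<inter> {0..<int m}) \<times> (B \<inter> {0..<int n})"
    then have "z \<in> ?f ` {0..<int (m * n)}"
      using bij by (auto simp: bij_betw_def)
    then obtain x where x: "x \<in> {0..<int (m * n)}" "z = ?f x"
      by blast
    with z A B have "x \<in> A \<inter> B" by auto
    with x show "z \<in> ?f ` (A \<inter> B \<inter> {0..<int (m * n)})"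
      by blast
  qed
  have inj: "inj_on ?f (A \<inter> B \<inter> {0..<int (m * n)})"
    using bij_betw_imp_inj_on[OF bij] by (rule inj_on_subset) blast
  have "card (A \<inter> B \<inter> {0..<int (m * n)})
      = card (A \<inter> {0..<int m}) * card (B \<inter> {0..<int n})"
    using card_image[OF inj] unfolding image by (simp add: card_cartesian_product)
  then show ?thesis
    by (simp add: periodic_dens_def)
qed

lemma mod_mem_iff_of_dvd:
  assumes "\<And>x. x mod int m \<in> A \<longleftrightarrow> x \<in> A" and "m dvd n"
  shows "x mod int n \<in> A \<longleftrightarrow> x \<in> A"
proof -
  have "x mod int n mod int m = x mod int m"
    using assms(2) by (simp add: mod_mod_cancel)
  then show ?thesis
    using assms(1)[of x] assms(1)[of "x mod int n"] by simp
qed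

lemma periodic_dens_INT:
  fixes m :: "'i \<Rightarrow> nat"
  assumes "finite I" and "\<And>i. i \<in> I \<Longrightarrow> m i > 0"
    and "\<And>i j. i \<in> I \<Longrightarrow> j \<in> I \<Longrightarrow> i \<noteq> j \<Longrightarrow> coprime (m i) (m j)"
    and "\<And>i x. i \<in> I \<Longrightarrow> x mod int (m i) \<in> A i \<longleftrightarrow> x \<in> A i"
  shows "periodic_dens (\<Prod>i\<in>I. m i) (\<Inter>i\<in>I. A i) = (\<Prod>i\<in>I. periodic_dens (m i) (A i))"
  using assms
proof (induction I rule: finite_induct)
  case empty
  show ?case by (simp add: periodic_dens_def)
next
  case (insert i I)
  have per: "x mod int (\<Prod>i\<in>I. m i) \<in> (\<Inter>i\<in>I. A i) \<longleftrightarrow> x \<in> (\<Inter>i\<in>I. A i)" for x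
  proof -
    have "x mod int (\<Prod>i\<in>I. m i) \<in> A j \<longleftrightarrow> x \<in> A j" if "j \<in> I" for j
    proof (rule mod_mem_iff_of_dvd)
      show "m j dvd (\<Prod>i\<in>I. m i)"
        using insert.hyps(1) that by (rule dvd_prodI)
    qed (use insert.prems(3) that in auto)
    then show ?thesis by blast
  qed
  have "coprime (m i) (\<Prod>i\<in>I. m i)"
    using insert.hyps(2) by (auto intro!: prod_coprime_right insert.prems(2))
  then have "periodic_dens (m i * (\<Prod>i\<in>I. m i)) (A i \<inter> (\<Inter>i\<in>I. A i))
      = periodic_dens (m i) (A i) * periodic_dens (\<Prod>i\<in>I. m i) (\<Inter>i\<in>I. A i)"
  proof (rule periodic_dens_Int)
    show "m i > 0" "(\<Prod>i\<in>I. m i) > 0"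
      using insert.prems(1) by (auto intro: prod_pos)
    show "x mod int (m i) \<in> A i \<longleftrightarrow> x \<in> A i" for x
      using insert.prems(3) by blast
  qed (rule per)
  also have "periodic_dens (\<Prod>i\<in>I. m i) (\<Inter>i\<in>I. A i) = (\<Prod>i\<in>I. periodic_dens (m i) (A i))"
    using insert.prems by (intro insert.IH) auto
  finally show ?case
    using insert.hyps by simp
qed

lemma periodic_dens_UN_disjoint:
  assumes "finite I" and "\<And>i j. i \<in> I \<Longrightarrow> j \<in> I \<Longrightarrow> i \<noteq> j \<Longrightarrow> A i \<inter> A j = {}"
  shows "periodic_dens L (\<Union>i\<in>I. A i) = (\<Sum>i\<in>I. periodic_dens L (A i))"
proof -
  have "card (\<Union>i\<in>I. A i \<inter> {0..<int L}) = (\<Sum>i\<in>I. card (A i \<inter> {0..<int L}))"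
    using assms by (intro card_UN_disjoint) auto
  moreover have "(\<Union>i\<in>I. A i) \<inter> {0..<int L} = (\<Union>i\<in>I. A i \<inter> {0..<int L})"
    by blast
  ultimately show ?thesis
    by (simp only: periodic_dens_def sum_divide_distrib of_nat_sum)
qed

section \<open>Sieving a residue class modulo 3\<close>

lemma mem_residue_class_iff: "x \<in> residue_class a n \<longleftrightarrow> int n dvd x - a"
  unfolding residue_class_def dvd_def by (auto simp: algebra_simps)

lemma mem_residue_class_iff_mod: "x \<in> residue_class a n \<longleftrightarrow> x mod int n = a mod int n"
  by (simp add: mem_residue_class_iff mod_eq_dvd_iff)

lemma periodic_dens_UNIV: "L > 0 \<Longrightarrow> periodic_dens L UNIV = 1"
  by (simp add: periodic_dens_def)

lemma periodic_dens_residue_class: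
  assumes "n > 0"
  shows "periodic_dens n (residue_class a n) = 1 / real n"
proof -
  have "residue_class a n \<inter> {0..<int n} = {a mod int n}"
    using assms by (auto simp: mem_residue_class_iff_mod)
  then show ?thesis
    by (simp add: periodic_dens_def)
qed

lemma periodic_dens_Compl:
  assumes "L > 0"
  shows "periodic_dens L (- A) = 1 - periodic_dens L A"
proof -
  have "(- A) \<inter> {0..<int L} = {0..<int L} - A \<inter> {0..<int L}"
    by blast
  then have "card ((- A) \<inter> {0..<int L}) = L - card (A \<inter> {0..<int L})"
    by (simp add: card_Diff_subset)
  moreover have "card (A \<inter> {0..<int L}) \<le> L"
    using card_mono[of "{0..<int L}" "A \<inter> {0..<int L}"] by simp
  ultimately show ?thesis
    using assms by (simp add: periodic_dens_def of_nat_diff diff_divide_distrib)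
qed

lemma mod_mem_residue_class_iff: "x mod int n \<in> residue_class a n \<longleftrightarrow> x \<in> residue_class a n"
  by (simp add: mem_residue_class_iff_mod)

text \<open>
  The class of \<open>a p\<close> modulo \<open>3 * p\<close> misses the class of \<open>c\<close> modulo \<open>3\<close> unless \<open>a p\<close> itself
  lies there; in that case it agrees inside this class with the class of \<open>a p\<close> modulo \<open>p\<close>. Hence
  the set is an intersection of one condition modulo \<open>3\<close> and one condition modulo each \<open>p\<close>.
\<close>

lemma dens_sieved_class_mod_3:
  assumes P: "finite P" "\<forall>p\<in>P. prime p" "3 \<notin> P"
  shows "periodic_dens (3 * \<Prod>P) (residue_class c 3 - (\<Union>p\<in>P. residue_class (a p) (3 * p)))
    = 1 / 3 * (\<Prod>p\<in>{p\<in>P. a p \<in> residue_class c 3}. 1 - 1 / real p)"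
proof -
  define A where "A p =
    (if p = 3 then residue_class c 3
     else if a p \<in> residue_class c 3 then - residue_class (a p) p else UNIV)" for p
  have local_cond: "x \<in> residue_class (a p) (3 * p) \<longleftrightarrow> x \<notin> A p"
    if "p \<in> P" and x: "x \<in> residue_class c 3" for p x
  proof -
    have "p \<noteq> 3" and "prime p" using that P by auto
    then have "coprime 3 p" by (simp add: primes_coprime)
    then have "coprime (3::int) (int p)"
      by (metis coprime_int_iff of_nat_numeral)
    then have split: "3 * int p dvd x - a p \<longleftrightarrow> 3 dvd x - a p \<and> int p dvd x - a p"
      by (auto intro: divides_mult dvd_mult_left dvd_mult_right)
    have "3 dvd x - a p \<longleftrightarrow> a p \<in> residue_class c 3"
      using x by (auto simp: mem_residue_class_iff_mod simp flip: mod_eq_dvd_iff)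
    with \<open>p \<noteq> 3\<close> split show ?thesis
      by (simp add: A_def mem_residue_class_iff[of x])
  qed
  have "residue_class c 3 - (\<Union>p\<in>P. residue_class (a p) (3 * p)) = (\<Inter>p\<in>insert 3 P. A p)"
    using local_cond by (auto simp: A_def[of 3])
  moreover have "3 * \<Prod>P = (\<Prod>p\<in>insert 3 P. p)"
    using P by simp
  ultimately have "periodic_dens (3 * \<Prod>P) (residue_class c 3 - (\<Union>p\<in>P. residue_class (a p) (3 * p)))
      = periodic_dens (\<Prod>p\<in>insert 3 P. p) (\<Inter>p\<in>insert 3 P. A p)"
    by simp
  also have "\<dots> = (\<Prod>p\<in>insert 3 P. periodic_dens p (A p))"
  proof (rule periodic_dens_INT)
    show "coprime p q" if "p \<in> insert 3 P" "q \<in> insert 3 P" "p \<noteq> q" for p q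
      using that P by (intro primes_coprime) auto
    show "x mod int p \<in> A p \<longleftrightarrow> x \<in> A p" for p x
      using mod_mem_residue_class_iff[of x p] mod_mem_residue_class_iff[of x 3]
      by (auto simp: A_def)
  qed (use P in \<open>auto simp: prime_gt_0_nat\<close>)
  also have "\<dots> = 1 / 3 * (\<Prod>p\<in>P. periodic_dens p (A p))"
    using P by (simp add: A_def periodic_dens_residue_class)
  also have "(\<Prod>p\<in>P. periodic_dens p (A p))
      = (\<Prod>p\<in>P. if a p \<in> residue_class c 3 then 1 - 1 / real p else 1)"
    using P by (intro prod.cong)
      (auto simp: A_def periodic_dens_Compl periodic_dens_residue_class periodic_dens_UNIV prime_gt_0_nat)
  also have "\<dots> = (\<Prod>p\<in>{p\<in>P. a p \<in> residue_class c 3}. 1 - 1 / real p)"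
    using P by (intro prod.inter_filter[symmetric])
  finally show ?thesis .
qed

section \<open>Choices of residues\<close>

text \<open>
  Distinctness allows the residues to be indexed by the elements of \<open>ps\<close> instead of by positions,
  so that a choice of residues becomes a function of the prime.
\<close>

lemma residue_tuples_map:
  assumes "distinct ps"
  shows "residue_tuples (k # map f ps)
    = {r # map a ps | r a. 0 \<le> r \<and> r < int k \<and> (\<forall>p\<in>set ps. 0 \<le> a p \<and> a p < int (f p))}"
    (is "_ = ?R")
proof (intro equalityI subsetI)
  fix as assume as: "as \<in> residue_tuples (k # map f ps)"
  then have len: "length as = Suc (length ps)"
    by (simp add: residue_tuples_def)
  then obtain r xs where as_eq: "as = r # xs" and len_xs: "length xs = length ps"
    by (metis length_Suc_conv)
  have bound: "0 \<le> as ! i \<and> as ! i < int ((k # map f ps) ! i)" if "i < Suc (length ps)" for i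
    using as that by (simp add: residue_tuples_def)
  define a where "a p = the (map_of (zip ps xs) p)" for p
  have a: "a (ps ! i) = xs ! i" if "i < length ps" for i
    using that assms len_xs by (simp add: a_def map_of_zip_nth)
  then have "xs = map a ps"
    using len_xs by (intro nth_equalityI) auto
  moreover have "0 \<le> r \<and> r < int k"
    using bound[of 0] as_eq by simp
  moreover have "0 \<le> a p \<and> a p < int (f p)" if "p \<in> set ps" for p
  proof -
    from that obtain i where "i < length ps" "ps ! i = p"
      by (auto simp: in_set_conv_nth)
    then show ?thesis
      using bound[of "Suc i"] as_eq a[of i] by simp
  qed
  ultimately show "as \<in> ?R"
    using as_eq by blast
next
  fix as assume "as \<in> ?R"
  then show "as \<in> residue_tuples (k # map f ps)"
    by (auto simp: residue_tuples_def nth_Cons split: nat.split)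
qed

lemma uncovered_map:
  "uncovered (k # map f ps) (r # map a ps)
    = - residue_class r k - (\<Union>p\<in>set ps. residue_class (a p) (f p))"
proof -
  have "(\<Union>i<length (k # map f ps). residue_class ((r # map a ps) ! i) ((k # map f ps) ! i))
      = residue_class r k \<union> (\<Union>i<length ps. residue_class (a (ps ! i)) (f (ps ! i)))"
    by (simp add: lessThan_Suc_eq_insert_0)
  also have "(\<Union>i<length ps. residue_class (a (ps ! i)) (f (ps ! i)))
      = (\<Union>p\<in>set ps. residue_class (a p) (f p))"
    by (force simp: in_set_conv_nth)
  finally show ?thesis
    by (auto simp: uncovered_def)
qed

lemma Lcm_3_primes:
  fixes P :: "nat set"
  assumes "finite P" "\<forall>p\<in>P. prime p"
  shows "Lcm (insert 3 ((\<lambda>p. 3 * p) ` P)) = 3 * \<Prod>P"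
  using assms
proof (induction P rule: finite_induct)
  case empty
  show ?case by simp
next
  case (insert p P)
  have "coprime p (\<Prod>P)"
    using insert.hyps(2) insert.prems by (auto intro!: prod_coprime_right primes_coprime)
  then have "lcm (3 * p) (3 * \<Prod>P) = 3 * (p * \<Prod>P)"
    by (simp add: lcm_mult_left lcm_coprime)
  moreover have "Lcm (insert 3 ((\<lambda>p. 3 * p) ` insert p P))
      = lcm (3 * p) (Lcm (insert 3 ((\<lambda>p. 3 * p) ` P)))"
    by (simp add: insert_commute[of 3])
  ultimately show ?case
    using insert by simp
qed

text \<open>
  The uncovered set is the disjoint union of what is left of the two classes modulo \<open>3\<close> other
  than that of \<open>r\<close>.
\<close>

lemma dens_uncovered:
  assumes P: "finite P" "\<forall>p\<in>P. prime p" "3 \<notin> P" and "set ps = P"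
    and r: "0 \<le> r" "r < 3"
  shows "periodic_dens (Lcm (set (3 # map (\<lambda>p. 3 * p) ps)))
      (uncovered (3 # map (\<lambda>p. 3 * p) ps) (r # map a ps))
    = 1 / 3 * (\<Sum>c\<in>{0, 1, 2} - {r}. \<Prod>p\<in>{p\<in>P. a p \<in> residue_class c 3}. 1 - 1 / real p)"
proof -
  have mem: "x \<in> residue_class c 3 \<longleftrightarrow> x mod 3 = c" if "c \<in> {0, 1, 2}" for x c
    using that by (auto simp: mem_residue_class_iff_mod)
  have r': "r \<in> {0, 1, 2}" using r by auto
  have range: "x mod 3 \<in> {0, 1, 2}" for x :: int
    by (simp, presburger)
  have "x \<notin> residue_class r 3 \<longleftrightarrow> (\<exists>c\<in>{0, 1, 2} - {r}. x \<in> residue_class c 3)" for x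
    using range[of x] r' by (auto simp: mem)
  then have "- residue_class r 3 = (\<Union>c\<in>{0, 1, 2} - {r}. residue_class c 3)"
    by (intro set_eqI) (simp only: Compl_iff UN_iff)
  then have "uncovered (3 # map (\<lambda>p. 3 * p) ps) (r # map a ps)
      = (\<Union>c\<in>{0, 1, 2} - {r}. residue_class c 3 - (\<Union>p\<in>P. residue_class (a p) (3 * p)))"
    using \<open>set ps = P\<close> by (simp only: uncovered_map UN_extend_simps)
  moreover have "Lcm (set (3 # map (\<lambda>p. 3 * p) ps)) = 3 * \<Prod>P"
    using Lcm_3_primes[OF P(1,2)] \<open>set ps = P\<close> by simp
  moreover have "periodic_dens (3 * \<Prod>P)
      (\<Union>c\<in>{0, 1, 2} - {r}. residue_class c 3 - (\<Union>p\<in>P. residue_class (a p) (3 * p)))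
    = (\<Sum>c\<in>{0, 1, 2} - {r}.
        periodic_dens (3 * \<Prod>P) (residue_class c 3 - (\<Union>p\<in>P. residue_class (a p) (3 * p))))"
  proof (rule periodic_dens_UN_disjoint)
    fix c d assume "c \<in> {0, 1, 2} - {r}" "d \<in> {0, 1, 2} - {r}" "c \<noteq> d"
    then have "residue_class c 3 \<inter> residue_class d 3 = {}"
      using mem[of c] mem[of d] by auto
    then show "(residue_class c 3 - (\<Union>p\<in>P. residue_class (a p) (3 * p))) \<inter>
        (residue_class d 3 - (\<Union>p\<in>P. residue_class (a p) (3 * p))) = {}"
      by blast
  qed simp
  ultimately show ?thesis
    by (simp only: dens_sieved_class_mod_3[OF P] sum_distrib_left)
qed

section \<open>Comparison of the two minima\<close>

lemma prod_one_minus_inverse_antimono: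
  assumes "finite B" "A \<subseteq> B" "\<forall>p\<in>B. prime p"
  shows "(\<Prod>p\<in>B. 1 - 1 / real p) \<le> (\<Prod>p\<in>A. 1 - 1 / real p)"
proof -
  have factor: "0 \<le> 1 - 1 / real p" "1 - 1 / real p \<le> 1" if "p \<in> B" for p
    using assms(3) that prime_ge_1_nat[of p] by simp_all
  have "(\<Prod>p\<in>B. 1 - 1 / real p) = (\<Prod>p\<in>B - A. 1 - 1 / real p) * (\<Prod>p\<in>A. 1 - 1 / real p)"
    using assms(1,2) by (simp only: prod.subset_diff)
  also have "\<dots> \<le> (\<Prod>p\<in>A. 1 - 1 / real p)"
    using factor assms(2) by (intro mult_left_le_one_le prod_nonneg prod_le_1) blast+
  finally show ?thesis .
qed

theorem proposition2:
  fixes P :: "nat set" and ps :: "nat list"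
  assumes "finite P" and "\<forall>p\<in>P. prime p" and "3 \<notin> P"
    and "distinct ps" and "set ps = P"
  shows "\<mu> (3 # map (\<lambda>p. 3 * p) ps) =
    1 / 3 * Min {(\<Prod>p\<in>P1. 1 - 1 / real p) + (\<Prod>p\<in>P2. 1 - 1 / real p) | P1 P2.
                   P1 \<inter> P2 = {} \<and> P1 \<union> P2 = P}"
proof -
  let ?ns = "3 # map (\<lambda>p. 3 * p) ps"
  let ?dens = "\<lambda>as. periodic_dens (Lcm (set ?ns)) (uncovered ?ns as)"
  let ?\<phi> = "\<lambda>Q. \<Prod>p\<in>Q. 1 - 1 / real p"
  let ?D = "{?dens as | as. as \<in> residue_tuples ?ns}"
  let ?V = "{?\<phi> P1 + ?\<phi> P2 | P1 P2. P1 \<inter> P2 = {} \<and> P1 \<union> P2 = P}"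
  note dens = dens_uncovered[OF assms(1,2,3,5)]
  note tuples = residue_tuples_map[OF assms(4), of 3 "\<lambda>p. 3 * p"]

  have finD: "finite ?D"
    using finite_residue_tuples[of ?ns] by (simp add: setcompr_eq_image)
  have neD: "?D \<noteq> {}"
    using residue_tuples_nonempty[of ?ns] assms(2,5) by (auto simp: prime_gt_0_nat)
  have "?V \<subseteq> (\<lambda>(P1, P2). ?\<phi> P1 + ?\<phi> P2) ` (Pow P \<times> Pow P)"
    by auto
  then have finV: "finite ?V"
    by (rule finite_subset) (use assms(1) in auto)
  have neV: "?V \<noteq> {}"
    by blast

  have upper: "\<exists>d\<in>?D. d = 1 / 3 * v" if v: "v \<in> ?V" for v
  proof -
    from v obtain P1 P2 where part: "P1 \<inter> P2 = {}" "P1 \<union> P2 = P" and v_eq: "v = ?\<phi> P1 + ?\<phi> P2"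
      by blast
    define a :: "nat \<Rightarrow> int" where "a p = (if p \<in> P1 then 1 else 2)" for p
    have bound: "0 \<le> a p \<and> a p < int (3 * p)" if "p \<in> set ps" for p
      using that assms(2,5) prime_gt_0_nat[of p] by (auto simp: a_def)
    have "0 # map a ps \<in> residue_tuples ?ns"
      unfolding tuples using bound by force
    then have "?dens (0 # map a ps) \<in> ?D"
      by blast
    moreover have "{p\<in>P. a p \<in> residue_class 1 3} = P1" "{p\<in>P. a p \<in> residue_class 2 3} = P2"
      using part by (auto simp: a_def mem_residue_class_iff)
    moreover have "{0, 1, 2} - {0} = {1, 2 :: int}"
      by auto
    ultimately show ?thesis
      using dens[of 0 a] v_eq by (intro bexI[of _ "?dens (0 # map a ps)"]) simp_all
  qed

  have lower: "\<exists>v\<in>?V. 1 / 3 * v \<le> d" if d: "d \<in> ?D" for d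
  proof -
    from d obtain r a where r: "0 \<le> r" "r < 3" and d_eq: "d = ?dens (r # map a ps)"
      unfolding tuples by auto
    define Q where "Q c = {p\<in>P. a p \<in> residue_class c 3}" for c
    have "r = 0 \<or> r = 1 \<or> r = 2"
      using r by auto
    then have "\<exists>c c'. c \<noteq> c' \<and> c \<in> {0, 1, 2} \<and> c' \<in> {0, 1, 2} \<and> {0, 1, 2} - {r} = {c, c'}"
    proof (elim disjE)
      assume "r = 0" then show ?thesis by (intro exI[of _ 1] exI[of _ 2]) auto
    next
      assume "r = 1" then show ?thesis by (intro exI[of _ 0] exI[of _ 2]) auto
    next
      assume "r = 2" then show ?thesis by (intro exI[of _ 0] exI[of _ 1]) auto
    qed
    then obtain c c' where c: "c \<noteq> c'" "c \<in> {0, 1, 2}" "c' \<in> {0, 1, 2}" "{0, 1, 2} - {r} = {c, c'}"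
      by blast
    have d_val: "d = 1 / 3 * (?\<phi> (Q c) + ?\<phi> (Q c'))"
      unfolding d_eq dens[OF r] c(4) Q_def using c(1) by simp
    have "Q c \<inter> Q c' = {}"
      using c(1-3) by (auto simp: Q_def mem_residue_class_iff_mod)
    \<comment> \<open>The second part is enlarged by the primes whose class falls into that of \<open>r\<close>.\<close>
    then have "?\<phi> (Q c) + ?\<phi> (P - Q c) \<in> ?V"
      by (intro CollectI exI[of _ "Q c"] exI[of _ "P - Q c"]) (auto simp: Q_def)
    moreover have "?\<phi> (P - Q c) \<le> ?\<phi> (Q c')"
      using \<open>Q c \<inter> Q c' = {}\<close> assms(1,2)
      by (intro prod_one_minus_inverse_antimono) (auto simp: Q_def)
    ultimately show ?thesis
      using d_val by (intro bexI[of _ "?\<phi> (Q c) + ?\<phi> (P - Q c)"]) auto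
  qed

  have "Min ?D \<le> 1 / 3 * Min ?V"
  proof -
    from upper[OF Min_in[OF finV neV]] obtain d where "d \<in> ?D" "d = 1 / 3 * Min ?V"
      by (elim bexE)
    with Min_le[OF finD \<open>d \<in> ?D\<close>] show ?thesis by simp
  qed
  moreover have "1 / 3 * Min ?V \<le> Min ?D"
  proof -
    from lower[OF Min_in[OF finD neD]] obtain v where "v \<in> ?V" "1 / 3 * v \<le> Min ?D"
      by (elim bexE)
    with Min_le[OF finV \<open>v \<in> ?V\<close>] show ?thesis by linarith
  qed
  ultimately show ?thesis
    unfolding \<mu>_def by linarith
qed

end
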